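(* Let $(B_1,\cdot_1,[\cdot,\cdot,\cdot]_1)$ and $(B_2,\cdot_2,[\cdot,\cdot,\cdot]_2)$ be two (finite-dimensional) transposed Poisson 3-Lie algebras over a field $\mathbb F$ of characteristic zero. For $x_i\in B_1$, $y_i\in B_2$, define linear maps $\cdot_{B_1\oplus B_2}:\otimes^2(B_1\oplus B_2)\to B_1\oplus B_2$ and $[\cdot,\cdot,\cdot]_{B_1\oplus B_2}:\otimes^3(B_1\oplus B_2)\to B_1\oplus B_2$ by $$(x_1+y_1)\cdot_{B_1\oplus B_2}(x_2+y_2)=x_1\cdot_1x_2+y_1\cdot_2y_2,$$ $$[x_1+y_1,x_2+y_2,x_3+y_3]_{B_1\oplus B_2}=[x_1,x_2,x_3]_1+[y_1,y_2,y_3]_2.$$ Then $(B_1\oplus B_2,\cdot_{B_1\oplus B_2},[\cdot,\cdot,\cdot]_{B_1\oplus B_2})$ is a transposed Poisson 3-Lie algebra.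
   Context: A 3-Lie algebra is a vector space with a skew-symmetric trilinear bracket satisfying $[x_1,x_2,[x_3,x_4,x_5]]=[[x_1,x_2,x_3],x_4,x_5]+[x_3,[x_1,x_2,x_4],x_5]+[x_3,x_4,[x_1,x_2,x_5]]$. A transposed Poisson 3-Lie algebra is a triple $(B,\cdot,[\cdot,\cdot,\cdot])$ where $(B,\cdot)$ is a commutative associative algebra (no unit assumed), $(B,[\cdot,\cdot,\cdot])$ is a 3-Lie algebra, and $3w\cdot[x,y,z]=[w\cdot x,y,z]+[x,w\cdot y,z]+[x,y,w\cdot z]$ for all $x,y,z,w\in B$. *)

theory Defs
  imports "HOL-Analysis.Product_Vector"
begin

text \<open>
  The carrier of each algebra is a whole type of class \<^class>\<open>ab_group_add\<close>, made into a vector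
  space by an explicit scalar multiplication, as in \<^locale>\<open>vector_space\<close>. The ground field has
  characteristic zero throughout, so that sign changes under transpositions are the right notion
  of skew-symmetry.
\<close>

locale comm_assoc_algebra = vector_space scale + abel_semigroup mult
  for scale :: "'f::field_char_0 \<Rightarrow> 'v::ab_group_add \<Rightarrow> 'v"
  and mult :: "'v \<Rightarrow> 'v \<Rightarrow> 'v" +
  assumes linear_mult_left: "Vector_Spaces.linear scale scale (\<lambda>x. mult x y)"
    and linear_mult_right: "Vector_Spaces.linear scale scale (\<lambda>y. mult x y)"

locale three_Lie_algebra = vector_space scale
  for scale :: "'f::field_char_0 \<Rightarrow> 'v::ab_group_add \<Rightarrow> 'v" +
  fixes bracket :: "'v \<Rightarrow> 'v \<Rightarrow> 'v \<Rightarrow> 'v"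
  assumes linear_bracket_1: "Vector_Spaces.linear scale scale (\<lambda>x. bracket x y z)"
    and linear_bracket_2: "Vector_Spaces.linear scale scale (\<lambda>y. bracket x y z)"
    and linear_bracket_3: "Vector_Spaces.linear scale scale (\<lambda>z. bracket x y z)"
    and skew_12: "bracket y x z = - bracket x y z"
    and skew_23: "bracket x z y = - bracket x y z"
    and skew_13: "bracket z y x = - bracket x y z"
    and fundamental_identity:
      "bracket x1 x2 (bracket x3 x4 x5) =
         bracket (bracket x1 x2 x3) x4 x5
         + bracket x3 (bracket x1 x2 x4) x5
         + bracket x3 x4 (bracket x1 x2 x5)"

locale transposed_Poisson_3_Lie_algebra =
  comm_assoc_algebra scale mult + three_Lie_algebra scale bracket
  for scale :: "'f::field_char_0 \<Rightarrow> 'v::ab_group_add \<Rightarrow> 'v"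
  and mult :: "'v \<Rightarrow> 'v \<Rightarrow> 'v"
  and bracket :: "'v \<Rightarrow> 'v \<Rightarrow> 'v \<Rightarrow> 'v" +
  assumes transposed_Leibniz:
    "scale 3 (mult w (bracket x y z)) =
       bracket (mult w x) y z + bracket x (mult w y) z + bracket x y (mult w z)"

text \<open>
  The direct sum of two vector spaces is the product type with the scalar multiplication
  \<^const>\<open>module_prod.scale\<close>; the element written $x + y$ on paper is the pair \<open>(x, y)\<close>.
\<close>

definition sum_mult ::
  "('a \<Rightarrow> 'a \<Rightarrow> 'a) \<Rightarrow> ('b \<Rightarrow> 'b \<Rightarrow> 'b) \<Rightarrow> 'a \<times> 'b \<Rightarrow> 'a \<times> 'b \<Rightarrow> 'a \<times> 'b"
  where "sum_mult m1 m2 = (\<lambda>(x1, y1) (x2, y2). (m1 x1 x2, m2 y1 y2))"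

definition sum_bracket ::
  "('a \<Rightarrow> 'a \<Rightarrow> 'a \<Rightarrow> 'a) \<Rightarrow> ('b \<Rightarrow> 'b \<Rightarrow> 'b \<Rightarrow> 'b)
    \<Rightarrow> 'a \<times> 'b \<Rightarrow> 'a \<times> 'b \<Rightarrow> 'a \<times> 'b \<Rightarrow> 'a \<times> 'b"
  where "sum_bracket b1 b2 =
    (\<lambda>(x1, y1) (x2, y2) (x3, y3). (b1 x1 x2 x3, b2 y1 y2 y3))"

end

theory Submission
  imports Defs
begin

text \<open>The operations of the direct sum, like its addition and scalar multiplication, act
  componentwise, so the two summands never interact. Each axiom is either linearity in one argument
  or a universally quantified identity, and such a condition passes to pairs as soon as it holds in
  both components. For linearity, freezing all but one argument of a sum operation leaves a product
  of two linear maps, one on each summand, which \<open>linear_map_prod\<close> covers; the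
  identities are compared coordinate by coordinate.\<close>

lemma linear_map_prod:
  assumes "Vector_Spaces.linear s1 s1' f" "Vector_Spaces.linear s2 s2' g"
  shows "Vector_Spaces.linear (module_prod.scale s1 s2) (module_prod.scale s1' s2') (map_prod f g)"
proof -
  interpret f: Vector_Spaces.linear s1 s1' f by fact
  interpret g: Vector_Spaces.linear s2 s2' g by fact
  interpret dom: vector_space_prod s1 s2 by unfold_locales
  interpret cod: vector_space_prod s1' s2' by unfold_locales
  show ?thesis
    by unfold_locales (auto simp: dom.scale_def cod.scale_def f.add g.add f.scale g.scale)
qed

text \<open>Projections instead of explicit pairs let this rewrite arguments that are variables,
  also those bound by a lambda.\<close>

lemma sum_mult_simps [simp]:
  "sum_mult m1 m2 p q = (m1 (fst p) (fst q), m2 (snd p) (snd q))"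
  by (simp add: sum_mult_def case_prod_beta)

lemma sum_bracket_simps [simp]:
  "sum_bracket b1 b2 p q r =
    (b1 (fst p) (fst q) (fst r), b2 (snd p) (snd q) (snd r))"
  by (simp add: sum_bracket_def case_prod_beta)

theorem proposition3p3:
  fixes scale1 :: "'f::field_char_0 \<Rightarrow> 'a::ab_group_add \<Rightarrow> 'a"
    and scale2 :: "'f \<Rightarrow> 'b::ab_group_add \<Rightarrow> 'b"
    and mult1 :: "'a \<Rightarrow> 'a \<Rightarrow> 'a"
    and mult2 :: "'b \<Rightarrow> 'b \<Rightarrow> 'b"
    and bracket1 :: "'a \<Rightarrow> 'a \<Rightarrow> 'a \<Rightarrow> 'a"
    and bracket2 :: "'b \<Rightarrow> 'b \<Rightarrow> 'b \<Rightarrow> 'b"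
  assumes "\<exists>Basis1. finite_dimensional_vector_space scale1 Basis1"
    and "\<exists>Basis2. finite_dimensional_vector_space scale2 Basis2"
    and "transposed_Poisson_3_Lie_algebra scale1 mult1 bracket1"
    and "transposed_Poisson_3_Lie_algebra scale2 mult2 bracket2"
  shows "transposed_Poisson_3_Lie_algebra (module_prod.scale scale1 scale2)
           (sum_mult mult1 mult2) (sum_bracket bracket1 bracket2)"
proof -
  interpret B1: transposed_Poisson_3_Lie_algebra scale1 mult1 bracket1 by fact
  interpret B2: transposed_Poisson_3_Lie_algebra scale2 mult2 bracket2 by fact
  interpret V: vector_space_prod scale1 scale2 by unfold_locales
  \<comment> \<open>This puts the product map into the projection form that
    \<open>sum_mult_simps\<close> and \<open>sum_bracket_simps\<close> produce, so that the rule
    unifies with the one-argument maps below.\<close>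
  note linear_sum = linear_map_prod [unfolded map_prod_def case_prod_unfold]
  show ?thesis
  proof (intro transposed_Poisson_3_Lie_algebra.intro comm_assoc_algebra.intro
      comm_assoc_algebra_axioms.intro three_Lie_algebra.intro three_Lie_algebra_axioms.intro
      transposed_Poisson_3_Lie_algebra_axioms.intro)
    show "abel_semigroup (sum_mult mult1 mult2)"
      by standard (simp_all add: B1.assoc B2.assoc, simp add: B1.commute B2.commute)
  next
    fix p q :: "'a \<times> 'b"
    show "Vector_Spaces.linear V.scale V.scale (\<lambda>p. sum_mult mult1 mult2 p q)"
      unfolding sum_mult_simps
      by (rule linear_sum [OF B1.linear_mult_left B2.linear_mult_left])
    show "Vector_Spaces.linear V.scale V.scale (\<lambda>q. sum_mult mult1 mult2 p q)"
      unfolding sum_mult_simps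
      by (rule linear_sum [OF B1.linear_mult_right B2.linear_mult_right])
  next
    fix p q r :: "'a \<times> 'b"
    show "Vector_Spaces.linear V.scale V.scale (\<lambda>p. sum_bracket bracket1 bracket2 p q r)"
      unfolding sum_bracket_simps
      by (rule linear_sum [OF B1.linear_bracket_1 B2.linear_bracket_1])
    show "Vector_Spaces.linear V.scale V.scale (\<lambda>q. sum_bracket bracket1 bracket2 p q r)"
      unfolding sum_bracket_simps
      by (rule linear_sum [OF B1.linear_bracket_2 B2.linear_bracket_2])
    show "Vector_Spaces.linear V.scale V.scale (\<lambda>r. sum_bracket bracket1 bracket2 p q r)"
      unfolding sum_bracket_simps
      by (rule linear_sum [OF B1.linear_bracket_3 B2.linear_bracket_3])
    show "sum_bracket bracket1 bracket2 q p r = - sum_bracket bracket1 bracket2 p q r"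
      \<comment> \<open>A general skew-symmetry rule would swap the arguments back and forth
        forever. Fixing the argument to be moved makes it fire only on the left-hand side; the next
        two swaps are treated likewise.\<close>
      by (simp add: B1.skew_12 [of "fst q"] B2.skew_12 [of "snd q"])
    show "sum_bracket bracket1 bracket2 p r q = - sum_bracket bracket1 bracket2 p q r"
      by (simp add: B1.skew_23 [of _ "fst r"] B2.skew_23 [of _ "snd r"])
    show "sum_bracket bracket1 bracket2 r q p = - sum_bracket bracket1 bracket2 p q r"
      by (simp add: B1.skew_13 [of "fst r"] B2.skew_13 [of "snd r"])
  \<comment> \<open>The fundamental identity is used to fold the three-term sum: its last summand is
    again a nested bracket of the same shape as its left-hand side, so expanding would not
    terminate.\<close>
  qed (simp_all add: V.scale_def V.p.vector_space_axioms
      B1.fundamental_identity [symmetric] B2.fundamental_identity [symmetric]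
      B1.transposed_Leibniz B2.transposed_Leibniz)
qed

end
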